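(* Let $(p_m(x))_m$ and $(q_m(x))_m$ be two families of linearly independent polynomials (the "monomials" in which the polynomials $P_n(x)$, respectively $Q_n(x)$, of degree $n$ are expanded), connected by linear operators $O_m$ through $q_m(x)=O_mp_m(x)$ for every $m$. Let $\mathcal{P}_m$ be the projection operators onto the basis elements $p_m(x)$, i.e. the linear operators with $\mathcal{P}_mp_n(x)=\delta_{mn}p_n(x)$. Then the operator $O=\sum_mO_m\mathcal{P}_m$ acts as umbral composition on the polynomials $P_n(x)$: if $P_n(x)=\sum_ma_{nm}p_m(x)$, then $$O\,P_n(x)=\sum_ma_{nm}q_m(x)=(P_n\circ Q)(x).$$
   Context: Umbral composition: if $P_n(x)=\sum_ma_{nm}p_m(x)$ is the expansion of $P_n$ in the family $(p_m)$, the umbral composition of $P_n$ with $Q$ is defined by $P_n\circ Q:=\sum_ma_{nm}q_m(x)$, that is, each $p_m$ is replaced by $q_m$ with the coefficients unchanged. The operators $\mathcal{P}_m$ and $O$ act on the span of the $p_m$, and each expansion is a finite sum. *)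

theory Defs
  imports "HOL-Computational_Algebra.Polynomial"
begin

global_interpretation poly_vs: vector_space "smult :: 'a::field \<Rightarrow> 'a poly \<Rightarrow> 'a poly"
  by unfold_locales (simp_all add: smult_add_right smult_add_left)

text \<open>Independence in the library is a property of sets; injectivity excludes repetitions in the
  family.\<close>

definition independent_family :: "(nat \<Rightarrow> 'a::field poly) \<Rightarrow> bool" where
  "independent_family p \<longleftrightarrow> inj p \<and> poly_vs.independent (range p)"

definition family_span :: "(nat \<Rightarrow> 'a::field poly) \<Rightarrow> 'a poly set" where
  "family_span p = poly_vs.span (range p)"

text \<open>Operators are total functions, but only their values on the subspace \<open>V\<close> matter.\<close>

definition linear_operator_on :: "'a::field poly set \<Rightarrow> ('a poly \<Rightarrow> 'a poly) \<Rightarrow> bool" where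
  "linear_operator_on V T \<longleftrightarrow>
     (\<forall>f\<in>V. \<forall>g\<in>V. T (f + g) = T f + T g) \<and> (\<forall>c. \<forall>f\<in>V. T (smult c f) = smult c (T f))"

definition lin_comb :: "(nat \<Rightarrow> 'a) \<Rightarrow> (nat \<Rightarrow> 'a::field poly) \<Rightarrow> 'a poly" where
  "lin_comb a p = (\<Sum>m | a m \<noteq> 0. smult (a m) (p m))"

definition is_expansion :: "(nat \<Rightarrow> 'a::field poly) \<Rightarrow> 'a poly \<Rightarrow> (nat \<Rightarrow> 'a) \<Rightarrow> bool" where
  "is_expansion p f a \<longleftrightarrow> finite {m. a m \<noteq> 0} \<and> f = lin_comb a p"

text \<open>Meaningful for an independent family \<open>p\<close> and \<open>f\<close> in its span, when the
  expansion exists and is unique. The composition with a sequence \<open>Q\<close> depends on \<open>Q\<close> only through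
  the family \<open>q\<close> in which \<open>Q\<close> is expanded.\<close>

definition umbral_comp ::
  "(nat \<Rightarrow> 'a::field poly) \<Rightarrow> (nat \<Rightarrow> 'a poly) \<Rightarrow> 'a poly \<Rightarrow> 'a poly" where
  "umbral_comp p q f = lin_comb (THE a. is_expansion p f a) q"

definition basis_projections ::
  "(nat \<Rightarrow> 'a::field poly) \<Rightarrow> (nat \<Rightarrow> 'a poly \<Rightarrow> 'a poly) \<Rightarrow> bool" where
  "basis_projections p Pr \<longleftrightarrow>
     (\<forall>m. linear_operator_on (family_span p) (Pr m)) \<and>
     (\<forall>m n. Pr m (p n) = (if m = n then p n else 0))"

text \<open>The operator \<open>\<Sum>\<^sub>m L\<^sub>m \<circ> Pr\<^sub>m\<close>, as a pointwise sum over the indices with nonzero projection;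
  this set of indices is finite on the span of the basis family.\<close>

definition umbral_operator ::
  "(nat \<Rightarrow> 'a::field poly \<Rightarrow> 'a poly) \<Rightarrow> (nat \<Rightarrow> 'a poly \<Rightarrow> 'a poly) \<Rightarrow> 'a poly \<Rightarrow> 'a poly" where
  "umbral_operator L Pr f = (\<Sum>m | Pr m f \<noteq> 0. L m (Pr m f))"

end

theory Submission
  imports Defs
begin

text \<open>Projections read off coefficients: applied to a finite expansion
  \<open>f = lin_comb c p\<close>, the operator \<open>Pr k\<close> leaves exactly the term
  \<open>smult (c k) (p k)\<close> (\<open>basis_projection_lin_comb\<close>). Applying
  \<open>L k\<close> turns this term into \<open>smult (c k) (q k)\<close>, and summing over
  \<open>k\<close> gives the expansion with every \<open>p k\<close> replaced by \<open>q k\<close>.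
  The same extraction, with \<open>p k\<close> nonzero, shows that the coefficients are unique
  (\<open>is_expansion_unique\<close>), so the \<open>THE\<close> in \<open>umbral_comp\<close>
  selects the given ones.\<close>

lemma family_in_span: "p n \<in> family_span p"
  unfolding family_span_def by (rule poly_vs.span_base) simp

lemma linear_operator_on_zero:
  assumes "linear_operator_on (family_span p) T"
  shows "T 0 = 0"
proof -
  have "T (smult 0 (p 0)) = smult 0 (T (p 0))"
    using assms family_in_span unfolding linear_operator_on_def by blast
  then show ?thesis by simp
qed

lemma linear_operator_on_sum:
  assumes T: "linear_operator_on (family_span p) T" and "finite A"
  shows "T (\<Sum>m\<in>A. smult (c m) (p m)) = (\<Sum>m\<in>A. smult (c m) (T (p m)))"
  using \<open>finite A\<close>
proof (induction A rule: finite_induct)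
  case empty
  then show ?case using linear_operator_on_zero[OF T] by simp
next
  case (insert k A)
  \<comment> \<open>\<open>T\<close> is known to be linear only on the span, so both summands must
    be placed there before additivity applies.\<close>
  have scaled: "smult (c m) (p m) \<in> family_span p" for m
    using family_in_span[of p m] unfolding family_span_def by (rule poly_vs.span_scale)
  have "(\<Sum>m\<in>A. smult (c m) (p m)) \<in> family_span p"
    using scaled unfolding family_span_def by (intro poly_vs.span_sum)
  then show ?case
    using T insert scaled[of k] family_in_span[of p k] by (simp add: linear_operator_on_def)
qed

lemma basis_projection_lin_comb:
  assumes "basis_projections p Pr" and "finite {m. c m \<noteq> 0}"
  shows "Pr k (lin_comb c p) = smult (c k) (p k)"
proof -
  have lin: "linear_operator_on (family_span p) (Pr k)"
    and val: "Pr k (p n) = (if k = n then p n else 0)" for n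
    using assms(1) by (auto simp: basis_projections_def)
  have "Pr k (lin_comb c p) = (\<Sum>m | c m \<noteq> 0. smult (c m) (Pr k (p m)))"
    unfolding lin_comb_def by (rule linear_operator_on_sum[OF lin assms(2)])
  also have "\<dots> = (\<Sum>m | c m \<noteq> 0. if k = m then smult (c m) (p m) else 0)"
    by (intro sum.cong) (auto simp: val)
  \<comment> \<open>If \<open>k\<close> lies outside the support, the sum is empty of nonzero terms
    and \<open>c k = 0\<close> makes the right side zero too.\<close>
  also have "\<dots> = smult (c k) (p k)"
    using assms(2) by simp
  finally show ?thesis .
qed

text \<open>This makes the pointwise sum in \<open>umbral_operator\<close> a genuine finite sum on
  the whole span, not the default value 0 of a sum over an infinite set. The elements of the span
  with finitely many nonzero projections form a subspace containing each \<open>p n\<close>, hence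
  they fill the span.\<close>

lemma finite_nonzero_projections:
  assumes "basis_projections p Pr" and "f \<in> family_span p"
  shows "finite {m. Pr m f \<noteq> 0}"
proof -
  let ?S = "{f \<in> family_span p. finite {m. Pr m f \<noteq> 0}}"
  have lin: "linear_operator_on (family_span p) (Pr m)"
    and val: "Pr m (p n) = (if m = n then p n else 0)" for m n
    using assms(1) by (auto simp: basis_projections_def)
  have "poly_vs.subspace ?S"
  proof (rule poly_vs.subspaceI)
    show "0 \<in> ?S"
      by (simp add: linear_operator_on_zero[OF lin] family_span_def poly_vs.span_zero)
  next
    fix f g assume fg: "f \<in> ?S" "g \<in> ?S"
    then have "{m. Pr m (f + g) \<noteq> 0} \<subseteq> {m. Pr m f \<noteq> 0} \<union> {m. Pr m g \<noteq> 0}"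
      using lin by (auto simp: linear_operator_on_def)
    with fg show "f + g \<in> ?S"
      by (auto simp: family_span_def poly_vs.span_add intro: finite_subset)
  next
    fix c f assume f: "f \<in> ?S"
    then have "{m. Pr m (smult c f) \<noteq> 0} \<subseteq> {m. Pr m f \<noteq> 0}"
      using lin by (auto simp: linear_operator_on_def)
    with f show "smult c f \<in> ?S"
      by (auto simp: family_span_def poly_vs.span_scale intro: finite_subset)
  qed
  moreover have "range p \<subseteq> ?S"
    by (auto simp: val family_in_span)
  ultimately have "family_span p \<subseteq> ?S"
    unfolding family_span_def[of p] by (intro poly_vs.span_minimal) (auto simp: family_span_def)
  with assms(2) show ?thesis by auto
qed

lemma independent_family_nonzero: "independent_family p \<Longrightarrow> p m \<noteq> 0"
  unfolding independent_family_def by (metis poly_vs.dependent_zero rangeI)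

text \<open>Both coefficients at \<open>k\<close> are read off from the same polynomial
  \<open>Pr k f\<close>, and the nonzero vector \<open>p k\<close> can be cancelled.\<close>

lemma is_expansion_unique:
  assumes "independent_family p" and "basis_projections p Pr"
    and "is_expansion p f c" and "is_expansion p f d"
  shows "c = d"
proof
  fix k
  have "smult (c k) (p k) = smult (d k) (p k)"
    using assms(3,4) basis_projection_lin_comb[OF assms(2)] by (metis is_expansion_def)
  with independent_family_nonzero[OF assms(1)] show "c k = d k"
    by (simp add: poly_vs.scale_right_imp_eq)
qed

lemma umbral_comp_eq_lin_comb:
  assumes "independent_family p" and "basis_projections p Pr" and "is_expansion p f c"
  shows "umbral_comp p q f = lin_comb c q"
proof -
  have "(THE c. is_expansion p f c) = c"
    using assms is_expansion_unique by blast
  then show ?thesis by (simp add: umbral_comp_def)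
qed

lemma umbral_operator_eq_lin_comb:
  assumes "independent_family p" and "basis_projections p Pr" and "is_expansion p f c"
    and L: "\<And>m. linear_operator_on (family_span p) (L m)"
  shows "umbral_operator L Pr f = lin_comb c (\<lambda>m. L m (p m))"
proof -
  have proj: "Pr m f = smult (c m) (p m)" for m
    using assms(2,3) basis_projection_lin_comb by (auto simp: is_expansion_def)
  have "L m (smult (c m) (p m)) = smult (c m) (L m (p m))" for m
    using L family_in_span unfolding linear_operator_on_def by blast
  \<comment> \<open>Since \<open>p m\<close> is nonzero, \<open>Pr m f\<close> vanishes exactly when
    \<open>c m\<close> does, so both sums range over the same indices.\<close>
  then show ?thesis
    by (simp add: umbral_operator_def lin_comb_def proj independent_family_nonzero[OF assms(1)])
qed

theorem theorem2p6:
  fixes p q P Q :: "nat \<Rightarrow> 'a::field poly"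
    and a b :: "nat \<Rightarrow> nat \<Rightarrow> 'a"
    and L Pr :: "nat \<Rightarrow> 'a poly \<Rightarrow> 'a poly"
  assumes "independent_family p" and "independent_family q"
    and "\<And>n. degree (P n) = n" and "\<And>n. is_expansion p (P n) (a n)"
    and "\<And>n. degree (Q n) = n" and "\<And>n. is_expansion q (Q n) (b n)"
    and "\<And>m. linear_operator_on (family_span p) (L m)"
    and "\<And>m. q m = L m (p m)"
    and "basis_projections p Pr"
  shows "(\<forall>f\<in>family_span p. finite {m. Pr m f \<noteq> 0}) \<and>
    (\<forall>n. umbral_operator L Pr (P n) = lin_comb (a n) q \<and>
         lin_comb (a n) q = umbral_comp p q (P n))"
proof (intro conjI ballI allI)
  fix f assume "f \<in> family_span p"
  with assms(9) show "finite {m. Pr m f \<noteq> 0}" by (rule finite_nonzero_projections)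
next
  fix n
  show "umbral_operator L Pr (P n) = lin_comb (a n) q"
    using umbral_operator_eq_lin_comb[OF assms(1,9,4,7)] by (simp flip: assms(8))
  show "lin_comb (a n) q = umbral_comp p q (P n)"
    by (rule umbral_comp_eq_lin_comb[OF assms(1,9,4), symmetric])
qed

end
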